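(* Let $\Omega\subset\mathbb{R}^3$ be a bounded, open, simply connected set with smooth boundary, and let $p>3$. For any $\nabla P_0\in\mathcal{P}$, the associated local-in-time physical classical solution $\nabla P$ of $\partial_t\nabla P+D^2P\,u=J(\nabla P-\mathrm{id}_\Omega)$ (the one constructed on the time interval $[0,\tau_*]$ as described in the context) admits the property that $$\mathrm{supp}\,\big(\nabla P(\cdot,t)\#\mathscr{L}_\Omega\big)\subset\subset\mathbb{R}^3\quad\text{for all } t\in[0,\tau_*],$$ i.e. the push-forward measure $\nabla P(\cdot,t)\#\mathscr{L}_\Omega$ has bounded support in $\mathbb{R}^3$.
   Context: Let $J=\begin{pmatrix}0&-1&0\\1&0&0\\0&0&0\end{pmatrix}$ and $\mathrm{id}_\Omega(x)=x$. Let $n$ be the outward unit normal on $\partial\Omega$. $\mathscr{L}_\Omega$ is the normalised restriction of Lebesgue measure on $\mathbb{R}^3$ to $\Omega$, and $\#$ denotes push-forward. The class of initial data is $$\mathcal{P}:=\{\nabla P_0\in W^{3,p}(\Omega,\mathbb{R}^3): D^2P_0(x)\xi\cdot\xi\ge\lambda|\xi|^2 \text{ for some } \lambda=\lambda(P_0)>0 \text{ and all } \xi\in\mathbb{R}^3,\ x\in\Omega\}.$$ $C^{k,\alpha}(\bar\Omega,\mathbb{R}^3)$ is the Hölder space of $\mathbb{R}^3$-valued maps, and $C^{k,\alpha}_\sigma(\bar\Omega,\mathbb{R}^3)$ is its subset of maps whose distributional divergence vanishes on $\Omega$. Definition. Suppose $\nabla P_0\in\mathcal{P}$ and $\alpha\in(0,1)$.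 The maps $\nabla P$ (for each $t$ the spatial gradient of a scalar function $P(\cdot,t)$ on $\Omega$) and $u$ constitute an associated local-in-time physical classical solution if and only if, for some $\tau>0$: (i) $\nabla P\in C^1(0,\tau;C^{2,\alpha}(\bar\Omega,\mathbb{R}^3))$ and $u\in C^0(0,\tau;C^{0,\alpha}_\sigma(\bar\Omega,\mathbb{R}^3))$; (ii) $\partial_t\nabla P(x,t)+D^2P(x,t)u(x,t)=J(\nabla P(x,t)-x)$ pointwise in the classical sense for all $x\in\Omega$ and $t\in(0,\tau)$, where $u$ is subject to the boundary condition $u\cdot n=0$ on $\partial\Omega$; (iii) there is $\lambda_*>0$ such that $D^2P(x,t)\xi\cdot\xi\ge\lambda_*|\xi|^2$ for all $\xi\in\mathbb{R}^3$, all $x\in\Omega$ and $t\in[0,\tau)$; (iv) $\nabla P(\cdot,0)=\nabla P_0$. The associated solution and its existence time $\tau_*$. The paper's existence theorem asserts that for every $\nabla P_0\in\mathcal{P}$ such a solution exists. It is constructed on $[0,\tau_*]$ as a limit, along a subsequence $N\to\infty$, of the piecewise-constant-in-time interpolants of the forward Euler scheme with time step $\varepsilon=\tau_*/N$, $T_0=\nabla P_0$, $T_{j+1}=T_j-\varepsilon(u_j\cdot\nabla)T_j+\varepsilon J(T_j-\mathrm{id}_\Omega)$, where $T_j=\nabla P_j$ and $u_j$ is the unique solution of $\nabla\wedge(D^2P_ju_j)=\nabla\wedge J(\nabla P_j-\mathrm{id}_\Omega)$, $\nabla\cdot u_j=0$ in $\Omega$, $u_j\cdot n=0$ on $\partial\Omega$.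 The time $\tau_*>0$ is $$\tau_*:=\frac{1}{1+2c_*}\log\Big(1+\frac{\lambda_0}{6C_M(\kappa+\|\nabla P_0\|_{W^{3,p}(\Omega,\mathbb{R}^3)})}\Big),\qquad \kappa:=\frac{\omega+2c_*|\Omega|^{1/p}}{1+2c_*},\qquad \omega:=\|J\,\mathrm{id}_\Omega\|_{W^{3,p}(\Omega,\mathbb{R}^3)}.$$ Here $\lambda_0>0$ is a uniform convexity constant of $P_0$, and $C_M$ is the constant in Morrey's inequality. Further, $c_*:=\max\{\sup_{\mu\le M_*}c(\lambda_0/2,\mu),\ \sup_{\mu\le M_*}c(\lambda_0,\mu)\}$ with $M_*:=\|D^2P_0\|_{C^{1,\alpha}(\bar\Omega,\mathbb{R}^{3\times3})}+\lambda_0/6$ ($\alpha$ here being the exponent given by Morrey's inequality). The number $c(\lambda,\mu)$ (depending also on $\Omega,p$) is the constant in the estimate $\|Aw\|_{W^{3,p}}\le c\|F\|_{W^{2,p}}$ for the solution $w$ of $\nabla\wedge(Aw)=F$, $\nabla\cdot w=0$, $w\cdot n=0$ on $\partial\Omega$, where $A(x)\xi\cdot\xi\ge\lambda|\xi|^2$ and $\mu=\|A\|_{C^{1,\alpha}(\bar\Omega,\mathbb{R}^{3\times3})}$. *)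

theory Defs
  imports "HOL-Analysis.Analysis"
begin

section \<open>Differential operators\<close>

definition partial :: "3 \<Rightarrow> (real^3 \<Rightarrow> 'a::real_normed_vector) \<Rightarrow> real^3 \<Rightarrow> 'a" where
  "partial i f x = frechet_derivative f (at x) (axis i 1)"

definition grad :: "(real^3 \<Rightarrow> real) \<Rightarrow> real^3 \<Rightarrow> real^3" where
  "grad f x = (\<chi> i. partial i f x)"

definition hess :: "(real^3 \<Rightarrow> real) \<Rightarrow> real^3 \<Rightarrow> real^3^3" where
  "hess f x = jacobian (grad f) (at x)"

definition divergence :: "(real^3 \<Rightarrow> real^3) \<Rightarrow> real^3 \<Rightarrow> real" where
  "divergence f x = (\<Sum>i\<in>UNIV. partial i f x $ i)"

definition curl :: "(real^3 \<Rightarrow> real^3) \<Rightarrow> real^3 \<Rightarrow> real^3" where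
  "curl f x = vector [partial 2 f x $ 3 - partial 3 f x $ 2,
                      partial 3 f x $ 1 - partial 1 f x $ 3,
                      partial 1 f x $ 2 - partial 2 f x $ 1]"

text \<open>Multi-indices are vectors of type \<^typ>\<open>nat^3\<close>.\<close>

definition mi_order :: "nat^3 \<Rightarrow> nat" where
  "mi_order a = (\<Sum>i\<in>UNIV. a $ i)"

definition mi_deriv :: "nat^3 \<Rightarrow> (real^3 \<Rightarrow> 'a::real_normed_vector) \<Rightarrow> real^3 \<Rightarrow> 'a" where
  "mi_deriv a f = (partial 1 ^^ (a $ 1)) ((partial 2 ^^ (a $ 2)) ((partial 3 ^^ (a $ 3)) f))"

text \<open>\<open>k\<close> times continuously differentiable; intended for open sets.\<close>

fun Ck_on :: "nat \<Rightarrow> (real^3) set \<Rightarrow> (real^3 \<Rightarrow> 'a::real_normed_vector) \<Rightarrow> bool" where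
  "Ck_on 0 S f = continuous_on S f"
| "Ck_on (Suc k) S f = (f differentiable_on S \<and> (\<forall>i. Ck_on k S (partial i f)))"

definition smooth_on :: "(real^3) set \<Rightarrow> (real^3 \<Rightarrow> 'a::real_normed_vector) \<Rightarrow> bool" where
  "smooth_on S f \<longleftrightarrow> (\<forall>k. Ck_on k S f)"

section \<open>Domains with smooth boundary\<close>

definition defining_function :: "(real^3) set \<Rightarrow> (real^3) set \<Rightarrow> (real^3 \<Rightarrow> real) \<Rightarrow> bool" where
  "defining_function \<Omega> U \<psi> \<longleftrightarrow>
     open U \<and> smooth_on U \<psi> \<and> (\<forall>x\<in>U. grad \<psi> x \<noteq> 0) \<and> \<Omega> \<inter> U = {x\<in>U. \<psi> x < 0}"

definition smooth_boundary :: "(real^3) set \<Rightarrow> bool" where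
  "smooth_boundary \<Omega> \<longleftrightarrow> (\<forall>x\<in>frontier \<Omega>. \<exists>U \<psi>. x \<in> U \<and> defining_function \<Omega> U \<psi>)"

text \<open>Outward because a defining function is negative inside the domain; at a boundary point
  the direction of its gradient is independent of the choice of the defining function.\<close>

definition outward_normal :: "(real^3) set \<Rightarrow> real^3 \<Rightarrow> real^3" where
  "outward_normal \<Omega> x = (THE n. \<exists>U \<psi>. x \<in> U \<and> defining_function \<Omega> U \<psi> \<and> n = sgn (grad \<psi> x))"

section \<open>Sobolev spaces\<close>

definition test_function :: "(real^3) set \<Rightarrow> (real^3 \<Rightarrow> real) \<Rightarrow> bool" where
  "test_function \<Omega> \<phi> \<longleftrightarrow>
     smooth_on UNIV \<phi> \<and> compact (closure {x. \<phi> x \<noteq> 0}) \<and> closure {x. \<phi> x \<noteq> 0} \<subseteq> \<Omega>"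

definition locally_integrable :: "(real^3) set \<Rightarrow> (real^3 \<Rightarrow> 'a::euclidean_space) \<Rightarrow> bool" where
  "locally_integrable \<Omega> f \<longleftrightarrow> (\<forall>K. compact K \<and> K \<subseteq> \<Omega> \<longrightarrow> integrable (lebesgue_on K) f)"

definition weak_deriv ::
  "(real^3) set \<Rightarrow> nat^3 \<Rightarrow> (real^3 \<Rightarrow> 'a::euclidean_space) \<Rightarrow> (real^3 \<Rightarrow> 'a) \<Rightarrow> bool" where
  "weak_deriv \<Omega> a f g \<longleftrightarrow>
     locally_integrable \<Omega> f \<and> locally_integrable \<Omega> g \<and>
     (\<forall>\<phi>. test_function \<Omega> \<phi> \<longrightarrow>
        (LINT x|lebesgue_on \<Omega>. mi_deriv a \<phi> x *\<^sub>R f x) =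
        (- 1) ^ mi_order a *\<^sub>R (LINT x|lebesgue_on \<Omega>. \<phi> x *\<^sub>R g x))"

definition Lp_on :: "real \<Rightarrow> (real^3) set \<Rightarrow> (real^3 \<Rightarrow> 'a::euclidean_space) \<Rightarrow> bool" where
  "Lp_on p \<Omega> f \<longleftrightarrow> f \<in> borel_measurable (lebesgue_on \<Omega>) \<and>
     integrable (lebesgue_on \<Omega>) (\<lambda>x. norm (f x) powr p)"

definition sobolev :: "nat \<Rightarrow> real \<Rightarrow> (real^3) set \<Rightarrow> (real^3 \<Rightarrow> 'a::euclidean_space) set" where
  "sobolev k p \<Omega> = {f. Lp_on p \<Omega> f \<and> (\<forall>a. mi_order a \<le> k \<longrightarrow> (\<exists>g. weak_deriv \<Omega> a f g \<and> Lp_on p \<Omega> g))}"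

text \<open>Weak derivatives are unique up to null sets, so the choice below does not affect the norm.\<close>

definition sobolev_norm :: "nat \<Rightarrow> real \<Rightarrow> (real^3) set \<Rightarrow> (real^3 \<Rightarrow> 'a::euclidean_space) \<Rightarrow> real" where
  "sobolev_norm k p \<Omega> f =
     (\<Sum>a | mi_order a \<le> k. LINT x|lebesgue_on \<Omega>. norm ((SOME g. weak_deriv \<Omega> a f g) x) powr p) powr (1 / p)"

definition div_free :: "(real^3) set \<Rightarrow> (real^3 \<Rightarrow> real^3) \<Rightarrow> bool" where
  "div_free \<Omega> u \<longleftrightarrow> (\<forall>\<phi>. test_function \<Omega> \<phi> \<longrightarrow> (LINT x|lebesgue_on \<Omega>. u x \<bullet> grad \<phi> x) = 0)"

section \<open>Hoelder spaces on the closure of a bounded open set\<close>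

text \<open>Elements are described by their values on the open set; uniform continuity of the derivatives
  says that they extend (uniquely) continuously to the closure and, the set being bounded,
  that they are bounded.\<close>

definition holder :: "nat \<Rightarrow> real \<Rightarrow> (real^3) set \<Rightarrow> (real^3 \<Rightarrow> 'a::real_normed_vector) set" where
  "holder k \<alpha> \<Omega> = {f. Ck_on k \<Omega> f \<and>
     (\<forall>a. mi_order a \<le> k \<longrightarrow> uniformly_continuous_on \<Omega> (mi_deriv a f)) \<and>
     (\<forall>a. mi_order a = k \<longrightarrow>
        (\<exists>C. \<forall>x\<in>\<Omega>. \<forall>y\<in>\<Omega>. norm (mi_deriv a f x - mi_deriv a f y) \<le> C * dist x y powr \<alpha>))}"

definition holder_seminorm :: "real \<Rightarrow> (real^3) set \<Rightarrow> (real^3 \<Rightarrow> 'a::real_normed_vector) \<Rightarrow> real" where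
  "holder_seminorm \<alpha> \<Omega> f =
     (SUP (x, y) \<in> {(x, y). x \<in> \<Omega> \<and> y \<in> \<Omega> \<and> x \<noteq> y}. norm (f x - f y) / dist x y powr \<alpha>)"

definition holder_norm :: "nat \<Rightarrow> real \<Rightarrow> (real^3) set \<Rightarrow> (real^3 \<Rightarrow> 'a::real_normed_vector) \<Rightarrow> real" where
  "holder_norm k \<alpha> \<Omega> f =
     (\<Sum>a | mi_order a \<le> k. SUP x\<in>\<Omega>. norm (mi_deriv a f x)) +
     (\<Sum>a | mi_order a = k. holder_seminorm \<alpha> \<Omega> (mi_deriv a f))"

text \<open>Curves of class \<open>C\<^sup>0\<close> and \<open>C\<^sup>1\<close> on the open interval from \<open>0\<close> to \<open>\<tau>\<close> with values in a
  Hoelder space, with respect to the norm of that space.\<close>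

definition C0_holder ::
  "real \<Rightarrow> nat \<Rightarrow> real \<Rightarrow> (real^3) set \<Rightarrow> (real \<Rightarrow> real^3 \<Rightarrow> 'a::real_normed_vector) \<Rightarrow> bool" where
  "C0_holder \<tau> k \<alpha> \<Omega> f \<longleftrightarrow> (\<forall>t\<in>{0<..<\<tau>}. f t \<in> holder k \<alpha> \<Omega> \<and>
     ((\<lambda>s. holder_norm k \<alpha> \<Omega> (\<lambda>x. f s x - f t x)) \<longlongrightarrow> 0) (at t))"

definition C1_holder ::
  "real \<Rightarrow> nat \<Rightarrow> real \<Rightarrow> (real^3) set \<Rightarrow> (real \<Rightarrow> real^3 \<Rightarrow> 'a::real_normed_vector) \<Rightarrow> bool" where
  "C1_holder \<tau> k \<alpha> \<Omega> f \<longleftrightarrow> (\<forall>t\<in>{0<..<\<tau>}. f t \<in> holder k \<alpha> \<Omega>) \<and>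
     (\<exists>f'. C0_holder \<tau> k \<alpha> \<Omega> f' \<and> (\<forall>t\<in>{0<..<\<tau>}.
        ((\<lambda>s. holder_norm k \<alpha> \<Omega> (\<lambda>x. (f s x - f t x) /\<^sub>R (s - t) - f' t x)) \<longlongrightarrow> 0) (at t)))"

section \<open>Initial data and physical classical solutions\<close>

definition Jmat :: "real^3^3" where
  "Jmat = vector [vector [0, - 1, 0], vector [1, 0, 0], vector [0, 0, 0]]"

definition uniformly_convex :: "(real^3) set \<Rightarrow> real \<Rightarrow> (real^3 \<Rightarrow> real) \<Rightarrow> bool" where
  "uniformly_convex \<Omega> lam P \<longleftrightarrow> (\<forall>x\<in>\<Omega>. \<forall>\<xi>. (hess P x *v \<xi>) \<bullet> \<xi> \<ge> lam * (norm \<xi>)\<^sup>2)"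

text \<open>\<open>\<nabla>P \<in> W\<^bsup>3,p\<^esup>\<close>, where, as \<open>p > 3\<close>, the Sobolev function is identified with its \<open>C\<^sup>2\<close>
  representative, so that \<open>D\<^sup>2P\<close> has pointwise values.\<close>

definition W3p_gradient :: "(real^3) set \<Rightarrow> real \<Rightarrow> (real^3 \<Rightarrow> real) \<Rightarrow> bool" where
  "W3p_gradient \<Omega> p P \<longleftrightarrow> P differentiable_on \<Omega> \<and> Ck_on 2 \<Omega> (grad P) \<and> grad P \<in> sobolev 3 p \<Omega>"

definition initial_datum :: "(real^3) set \<Rightarrow> real \<Rightarrow> (real^3 \<Rightarrow> real) \<Rightarrow> bool" where
  "initial_datum \<Omega> p P \<longleftrightarrow> W3p_gradient \<Omega> p P \<and> (\<exists>lam>0. uniformly_convex \<Omega> lam P)"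

text \<open>\<open>\<tau>\<close> is the existence time. Continuity of \<open>u t\<close> on the closure says that the boundary values of
  \<open>u t\<close> are those of its extension from \<open>\<Omega>\<close>.\<close>

definition physical_classical_solution ::
  "(real^3) set \<Rightarrow> real \<Rightarrow> (real^3 \<Rightarrow> real) \<Rightarrow> real \<Rightarrow> (real \<Rightarrow> real^3 \<Rightarrow> real) \<Rightarrow> (real \<Rightarrow> real^3 \<Rightarrow> real^3) \<Rightarrow> bool"
where
  "physical_classical_solution \<Omega> \<alpha> P\<^sub>0 \<tau> P u \<longleftrightarrow>
     \<tau> > 0 \<and>
     (\<forall>t\<in>{0..<\<tau>}. P t differentiable_on \<Omega> \<and> grad (P t) differentiable_on \<Omega>) \<and>
     C1_holder \<tau> 2 \<alpha> \<Omega> (\<lambda>t. grad (P t)) \<and>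
     C0_holder \<tau> 0 \<alpha> \<Omega> u \<and>
     (\<forall>t\<in>{0<..<\<tau>}. continuous_on (closure \<Omega>) (u t) \<and> div_free \<Omega> (u t)) \<and>
     (\<forall>t\<in>{0<..<\<tau>}. \<forall>x\<in>\<Omega>. \<exists>d. ((\<lambda>s. grad (P s) x) has_vector_derivative d) (at t) \<and>
        d + hess (P t) x *v u t x = Jmat *v (grad (P t) x - x)) \<and>
     (\<forall>t\<in>{0<..<\<tau>}. \<forall>x\<in>frontier \<Omega>. u t x \<bullet> outward_normal \<Omega> x = 0) \<and>
     (\<exists>lam>0. \<forall>t\<in>{0..<\<tau>}. uniformly_convex \<Omega> lam (P t)) \<and>
     (\<forall>x\<in>\<Omega>. grad (P 0) x = grad P\<^sub>0 x)"

section \<open>The forward Euler scheme and the constructed solution\<close>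

definition div_curl_solution ::
  "(real^3) set \<Rightarrow> (real^3 \<Rightarrow> real^3^3) \<Rightarrow> (real^3 \<Rightarrow> real^3) \<Rightarrow> (real^3 \<Rightarrow> real^3) \<Rightarrow> bool" where
  "div_curl_solution \<Omega> A F w \<longleftrightarrow>
     continuous_on (closure \<Omega>) w \<and> Ck_on 1 \<Omega> w \<and>
     (\<forall>x\<in>\<Omega>. curl (\<lambda>y. A y *v w y) x = F x) \<and>
     (\<forall>x\<in>\<Omega>. divergence w x = 0) \<and>
     (\<forall>x\<in>frontier \<Omega>. w x \<bullet> outward_normal \<Omega> x = 0)"

text \<open>\<open>Q j\<close> is the potential of the \<open>j\<close>-th iterate, i.e. \<open>T\<^sub>j = \<nabla>Q\<^sub>j\<close>.\<close>

definition euler_scheme ::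
  "(real^3) set \<Rightarrow> real \<Rightarrow> (real^3 \<Rightarrow> real) \<Rightarrow> real \<Rightarrow> nat \<Rightarrow> (nat \<Rightarrow> real^3 \<Rightarrow> real) \<Rightarrow> (nat \<Rightarrow> real^3 \<Rightarrow> real^3) \<Rightarrow> bool"
where
  "euler_scheme \<Omega> p P\<^sub>0 \<epsilon> N Q u \<longleftrightarrow>
     (\<forall>x\<in>\<Omega>. grad (Q 0) x = grad P\<^sub>0 x) \<and>
     (\<forall>j\<le>N. W3p_gradient \<Omega> p (Q j)) \<and>
     (\<forall>j<N. div_curl_solution \<Omega> (hess (Q j)) (curl (\<lambda>y. Jmat *v (grad (Q j) y - y))) (u j)) \<and>
     (\<forall>j<N. \<forall>x\<in>\<Omega>. grad (Q (Suc j)) x =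
        grad (Q j) x - \<epsilon> *\<^sub>R (hess (Q j) x *v u j x) + \<epsilon> *\<^sub>R (Jmat *v (grad (Q j) x - x)))"

definition interpolant :: "real \<Rightarrow> (nat \<Rightarrow> real^3 \<Rightarrow> real) \<Rightarrow> real \<Rightarrow> real^3 \<Rightarrow> real^3" where
  "interpolant \<epsilon> Q t = grad (Q (nat \<lfloor>t / \<epsilon>\<rfloor>))"

definition constructed_solution ::
  "(real^3) set \<Rightarrow> real \<Rightarrow> real \<Rightarrow> (real^3 \<Rightarrow> real) \<Rightarrow> real \<Rightarrow> (real \<Rightarrow> real^3 \<Rightarrow> real) \<Rightarrow> (real \<Rightarrow> real^3 \<Rightarrow> real^3) \<Rightarrow> bool"
where
  "constructed_solution \<Omega> p \<alpha> P\<^sub>0 \<tau> P u \<longleftrightarrow>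
     physical_classical_solution \<Omega> \<alpha> P\<^sub>0 \<tau> P u \<and> P \<tau> differentiable_on \<Omega> \<and>
     (\<exists>Q v r. (\<forall>N\<ge>1. euler_scheme \<Omega> p P\<^sub>0 (\<tau> / real N) N (Q N) (v N)) \<and> strict_mono (r :: nat \<Rightarrow> nat) \<and>
        (\<forall>t\<in>{0..\<tau>}. uniform_limit \<Omega> (\<lambda>k. interpolant (\<tau> / real (r k)) (Q (r k)) t) (grad (P t)) sequentially))"

section \<open>The existence time\<close>

text \<open>Morrey's inequality in the form \<open>W\<^bsup>3,p\<^esup> \<subseteq> C\<^bsup>2,1-3/p\<^esup>\<close> in which it is applied to gradients.\<close>

definition morrey_constant :: "(real^3) set \<Rightarrow> real \<Rightarrow> real \<Rightarrow> bool" where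
  "morrey_constant \<Omega> p C \<longleftrightarrow> C > 0 \<and>
     (\<forall>f \<in> sobolev 3 p \<Omega>. \<exists>g \<in> holder 2 (1 - 3 / p) \<Omega>. (AE x in lebesgue_on \<Omega>. f x = g x) \<and>
        holder_norm 2 (1 - 3 / p) \<Omega> (g :: real^3 \<Rightarrow> real^3) \<le> C * sobolev_norm 3 p \<Omega> f)"

definition div_curl_estimate :: "(real^3) set \<Rightarrow> real \<Rightarrow> real \<Rightarrow> real \<Rightarrow> real \<Rightarrow> bool" where
  "div_curl_estimate \<Omega> p lam \<mu> C \<longleftrightarrow> C \<ge> 0 \<and>
     (\<forall>A F w. A \<in> holder 1 (1 - 3 / p) \<Omega> \<and> holder_norm 1 (1 - 3 / p) \<Omega> A = \<mu> \<and>
        (\<forall>x\<in>\<Omega>. \<forall>\<xi>. (A x *v \<xi>) \<bullet> \<xi> \<ge> lam * (norm \<xi>)\<^sup>2) \<and>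
        F \<in> sobolev 2 p \<Omega> \<and> div_curl_solution \<Omega> A F w \<longrightarrow>
        (\<lambda>x. A x *v w x) \<in> sobolev 3 p \<Omega> \<and>
        sobolev_norm 3 p \<Omega> (\<lambda>x. A x *v w x) \<le> C * sobolev_norm 2 p \<Omega> F)"

text \<open>\<open>c lam \<mu>\<close> is a constant for the estimate. The defining property is asked for only where the
  estimate holds with some constant, so that admissible functions \<open>c\<close> exist unconditionally.\<close>

definition div_curl_constant :: "(real^3) set \<Rightarrow> real \<Rightarrow> (real \<Rightarrow> real \<Rightarrow> real) \<Rightarrow> bool" where
  "div_curl_constant \<Omega> p c \<longleftrightarrow>
     (\<forall>lam \<mu>. c lam \<mu> \<ge> 0 \<and> ((\<exists>C. div_curl_estimate \<Omega> p lam \<mu> C) \<longrightarrow> div_curl_estimate \<Omega> p lam \<mu> (c lam \<mu>)))"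

definition M_star :: "(real^3) set \<Rightarrow> real \<Rightarrow> (real^3 \<Rightarrow> real) \<Rightarrow> real \<Rightarrow> real" where
  "M_star \<Omega> p P\<^sub>0 lam0 = holder_norm 1 (1 - 3 / p) \<Omega> (hess P\<^sub>0) + lam0 / 6"

text \<open>\<open>\<mu>\<close> stands for a norm and therefore ranges over nonnegative numbers only.\<close>

definition c_star :: "(real^3) set \<Rightarrow> real \<Rightarrow> (real^3 \<Rightarrow> real) \<Rightarrow> real \<Rightarrow> (real \<Rightarrow> real \<Rightarrow> real) \<Rightarrow> real" where
  "c_star \<Omega> p P\<^sub>0 lam0 c = max (SUP \<mu>\<in>{0..M_star \<Omega> p P\<^sub>0 lam0}. c (lam0 / 2) \<mu>)
                            (SUP \<mu>\<in>{0..M_star \<Omega> p P\<^sub>0 lam0}. c lam0 \<mu>)"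

definition tau_star ::
  "(real^3) set \<Rightarrow> real \<Rightarrow> (real^3 \<Rightarrow> real) \<Rightarrow> real \<Rightarrow> real \<Rightarrow> (real \<Rightarrow> real \<Rightarrow> real) \<Rightarrow> real" where
  "tau_star \<Omega> p P\<^sub>0 lam0 C\<^sub>M c =
     (let cs = c_star \<Omega> p P\<^sub>0 lam0 c;
          \<omega> = sobolev_norm 3 p \<Omega> (\<lambda>x. Jmat *v x);
          \<kappa> = (\<omega> + 2 * cs * measure lebesgue \<Omega> powr (1 / p)) / (1 + 2 * cs)
      in 1 / (1 + 2 * cs) * ln (1 + lam0 / (6 * C\<^sub>M * (\<kappa> + sobolev_norm 3 p \<Omega> (grad P\<^sub>0)))))"

section \<open>Push-forward measures\<close>

text \<open>A measure on the space \<open>\<Omega>\<close> itself, so that maps need to be measurable on \<open>\<Omega>\<close> only.\<close>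

definition normalised_lebesgue :: "(real^3) set \<Rightarrow> (real^3) measure" where
  "normalised_lebesgue \<Omega> = uniform_measure (lebesgue_on \<Omega>) \<Omega>"

definition measure_support :: "'a::topological_space measure \<Rightarrow> 'a set" where
  "measure_support M = {y. \<forall>U. open U \<and> y \<in> U \<longrightarrow> emeasure M U > 0}"

end

theory Submission
  imports Defs
begin

text \<open>The time slice of the constructed solution at any time up to and including \<open>\<tau>\<^sub>*\<close> is a
  uniform limit of Euler iterates. Their gradients lie in \<open>W\<^bsup>3,p\<^esup>\<close> and are continuous, so Morrey's
  inequality makes each of them bounded on the domain. Hence the limit map is bounded as well,
  and the support of the push-forward lies in the closure of its range.\<close>

lemma closed_measure_support: "closed (measure_support M)"
proof -
  have "- measure_support M = \<Union>{U. open U \<and> emeasure M U = 0}"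
    unfolding measure_support_def by (auto simp: zero_less_iff_neq_zero)
  then show ?thesis
    unfolding closed_def by auto
qed

text \<open>The complement of the closed range is an open set with empty preimage, so no point of it
  can belong to the support. Measurability of \<open>f\<close> does not enter.\<close>

lemma measure_support_distr_subset:
  fixes f :: "'a \<Rightarrow> 'b::topological_space"
  shows "measure_support (distr M borel f) \<subseteq> closure (f ` space M)"
proof
  fix y assume y: "y \<in> measure_support (distr M borel f)"
  define U where "U = - closure (f ` space M)"
  have "f -` U \<inter> space M = {}"
    using closure_subset[of "f ` space M"] by (auto simp: U_def)
  \<comment> \<open>\<open>measure_of\<close> returns either the prescribed value, here the measure
    of the empty preimage, or the default 0; both cases give 0.\<close>
  then have "emeasure (distr M borel f) U = 0"
    unfolding distr_def by (simp add: emeasure_measure_of_conv)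
  moreover have "open U"
    by (simp add: U_def open_Compl)
  ultimately show "y \<in> closure (f ` space M)"
    using y unfolding measure_support_def U_def by fastforce
qed

lemma compact_measure_support_distr:
  fixes f :: "'a \<Rightarrow> 'b::heine_borel"
  assumes "bounded (f ` space M)"
  shows "compact (measure_support (distr M borel f))"
  using assms closed_measure_support measure_support_distr_subset
  by (metis bounded_closure bounded_subset compact_eq_bounded_closed)

text \<open>In a Hausdorff codomain the set of disagreement is open, as the preimage of the
  complement of the diagonal; being null as well, it is empty.\<close>

lemma AE_lebesgue_on_continuous_eq:
  fixes f g :: "'a::euclidean_space \<Rightarrow> 'b::t2_space"
  assumes "open S" and "continuous_on S f" and "continuous_on S g"
    and "AE x in lebesgue_on S. f x = g x" and "x \<in> S"
  shows "f x = g x"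
proof -
  define D where "D = {x\<in>S. f x \<noteq> g x}"
  have "open (S \<inter> (\<lambda>x. (f x, g x)) -` {(a, b) |a b. a \<noteq> b})"
    using assms(1-3)
    by (intro continuous_open_preimage continuous_on_Pair open_diagonal_complement)
  moreover have "S \<inter> (\<lambda>x. (f x, g x)) -` {(a, b) |a b. a \<noteq> b} = D"
    by (auto simp: D_def)
  ultimately have "open D"
    by simp
  have "AE x in lebesgue. x \<in> S \<longrightarrow> f x = g x"
    using assms by (simp add: AE_restrict_space_iff)
  then have "AE x in lebesgue. x \<notin> D"
    by eventually_elim (auto simp: D_def)
  then have "negligible D"
    using \<open>open D\<close> by (simp add: negligible_iff_null_sets AE_iff_null_sets borel_open)
  then have "D = {}"
    using \<open>open D\<close> open_not_negligible by blast
  then show ?thesis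
    using \<open>x \<in> S\<close> by (auto simp: D_def)
qed

lemma holder_uniformly_continuous_on:
  assumes "f \<in> holder k \<alpha> S"
  shows "uniformly_continuous_on S f"
proof -
  \<comment> \<open>The zero multi-index turns the condition on derivatives into one on
    \<open>f\<close> itself.\<close>
  have "mi_order 0 \<le> k" and "mi_deriv 0 f = f"
    by (simp_all add: mi_order_def mi_deriv_def)
  then show ?thesis
    using assms unfolding holder_def by force
qed

text \<open>Morrey's inequality controls only an almost-everywhere representative \<open>g\<close>;
  continuity of both maps upgrades this to equality at every point, so the actual range is
  bounded.\<close>

lemma bounded_image_W3p_gradient:
  assumes "open S" and "bounded S" and "morrey_constant S p C" and "W3p_gradient S p Q"
  shows "bounded (grad Q ` S)"
proof -
  obtain g where g: "g \<in> holder 2 (1 - 3 / p) S" "AE x in lebesgue_on S. grad Q x = g x"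
    using assms(3,4) unfolding morrey_constant_def W3p_gradient_def by blast
  have "uniformly_continuous_on S g"
    using g(1) by (rule holder_uniformly_continuous_on)
  moreover have "continuous_on S (grad Q)"
    using assms(4) unfolding W3p_gradient_def
    by (auto simp: numeral_2_eq_2 intro: differentiable_imp_continuous_on)
  ultimately have "\<And>x. x \<in> S \<Longrightarrow> grad Q x = g x"
    using AE_lebesgue_on_continuous_eq[OF \<open>open S\<close> _ _ g(2)]
    by (auto intro: uniformly_continuous_imp_continuous)
  then have "grad Q ` S = g ` S"
    by (rule image_cong[OF refl])
  then show ?thesis
    using bounded_uniformly_continuous_image[OF \<open>uniformly_continuous_on S g\<close> \<open>bounded S\<close>] by simp
qed

lemma bounded_image_interpolant:
  assumes "open S" and "bounded S" and "morrey_constant S p C"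
    and "euler_scheme S p P\<^sub>0 (\<tau> / real N) N Q v"
    and "0 < \<tau>" and "0 < N" and "t \<in> {0..\<tau>}"
  shows "bounded (interpolant (\<tau> / real N) Q t ` S)"
proof -
  \<comment> \<open>At \<open>t = \<tau>\<close> the interpolant takes the iterate of index
    \<open>N\<close>, the last one that the scheme places in the Sobolev class.\<close>
  have "t / (\<tau> / real N) \<le> real N"
    using assms(5-7) by (simp add: field_simps)
  then have "nat \<lfloor>t / (\<tau> / real N)\<rfloor> \<le> N"
    by linarith
  then show ?thesis
    using assms(1-4) unfolding interpolant_def euler_scheme_def
    by (blast intro: bounded_image_W3p_gradient)
qed

text \<open>A single bounded \<open>f k\<close> within distance 1 of \<open>g\<close> on all of
  \<open>S\<close> suffices.\<close>

lemma bounded_image_uniform_limit: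
  fixes f :: "'a \<Rightarrow> 'b \<Rightarrow> 'c::real_normed_vector"
  assumes "uniform_limit S f g F" and "\<exists>\<^sub>F k in F. bounded (f k ` S)"
  shows "bounded (g ` S)"
proof -
  have "\<forall>\<^sub>F k in F. \<forall>x\<in>S. dist (f k x) (g x) < 1"
    using assms(1) by (simp add: uniform_limit_iff)
  then obtain k where b: "bounded (f k ` S)" and d: "\<And>x. x \<in> S \<Longrightarrow> dist (f k x) (g x) < 1"
    using frequently_ex[OF frequently_eventually_conj[OF assms(2)]] by blast
  obtain B where B: "\<And>x. x \<in> S \<Longrightarrow> norm (f k x) \<le> B"
    using b by (auto simp: bounded_iff)
  have "norm (g x) \<le> B + 1" if "x \<in> S" for x
    using B[OF that] d[OF that] norm_triangle_ineq2[of "g x" "f k x"]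
    by (simp add: dist_norm norm_minus_commute)
  then show ?thesis
    by (auto simp: bounded_iff)
qed

text \<open>The uniform limit is available on the closed time interval, whereas the Hoelder
  regularity of the solution covers only the open one; this is how both endpoints are
  reached.\<close>

lemma constructed_solution_bounded_image:
  assumes "open S" and "bounded S" and "morrey_constant S p C"
    and "constructed_solution S p \<alpha> P\<^sub>0 \<tau> P u" and "t \<in> {0..\<tau>}"
  shows "bounded (grad (P t) ` S)"
proof -
  obtain Q v r where eul: "\<And>N. 1 \<le> N \<Longrightarrow> euler_scheme S p P\<^sub>0 (\<tau> / real N) N (Q N) (v N)"
    and r: "strict_mono (r :: nat \<Rightarrow> nat)"
    and lim: "uniform_limit S (\<lambda>k. interpolant (\<tau> / real (r k)) (Q (r k)) t) (grad (P t)) sequentially"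
    using assms(4,5) unfolding constructed_solution_def by blast
  have "\<tau> > 0"
    using assms(4) by (simp add: constructed_solution_def physical_classical_solution_def)
  have "bounded (interpolant (\<tau> / real (r k)) (Q (r k)) t ` S)" if "k \<ge> 1" for k
  proof -
    \<comment> \<open>Strict monotonicity gives \<open>k \<le> r k\<close>. The index 0 is left out
      because \<open>r 0\<close> may be 0, which is no admissible number of time steps.\<close>
    have "r k \<ge> 1"
      using that strict_mono_imp_increasing[OF r, of k] by linarith
    then show ?thesis
      using assms \<open>\<tau> > 0\<close> eul by (intro bounded_image_interpolant) auto
  qed
  then have "\<forall>\<^sub>F k in sequentially. bounded (interpolant (\<tau> / real (r k)) (Q (r k)) t ` S)"
    by (auto simp: eventually_sequentially)
  then show ?thesis
    by (intro bounded_image_uniform_limit[OF lim] eventually_frequently) simp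
qed

theorem corollary1p3:
  fixes \<Omega> :: "(real^3) set" and p \<alpha> lam0 C\<^sub>M :: real and c :: "real \<Rightarrow> real \<Rightarrow> real"
    and P\<^sub>0 :: "real^3 \<Rightarrow> real" and P :: "real \<Rightarrow> real^3 \<Rightarrow> real" and u :: "real \<Rightarrow> real^3 \<Rightarrow> real^3"
  assumes "open \<Omega>" and "bounded \<Omega>" and "simply_connected \<Omega>" and "smooth_boundary \<Omega>"
    and "p > 3" and "0 < \<alpha>" and "\<alpha> < 1"
    and "initial_datum \<Omega> p P\<^sub>0"
    and "lam0 > 0" and "uniformly_convex \<Omega> lam0 P\<^sub>0"
    and "morrey_constant \<Omega> p C\<^sub>M"
    and "div_curl_constant \<Omega> p c"
    and "bdd_above (c (lam0 / 2) ` {0..M_star \<Omega> p P\<^sub>0 lam0})"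
    and "bdd_above (c lam0 ` {0..M_star \<Omega> p P\<^sub>0 lam0})"
    and "constructed_solution \<Omega> p \<alpha> P\<^sub>0 (tau_star \<Omega> p P\<^sub>0 lam0 C\<^sub>M c) P u"
  shows "\<forall>t\<in>{0..tau_star \<Omega> p P\<^sub>0 lam0 C\<^sub>M c}.
    compact (measure_support (distr (normalised_lebesgue \<Omega>) borel (grad (P t))))"
proof
  fix t assume "t \<in> {0..tau_star \<Omega> p P\<^sub>0 lam0 C\<^sub>M c}"
  then have "bounded (grad (P t) ` \<Omega>)"
    using assms constructed_solution_bounded_image by blast
  \<comment> \<open>The measure lives on \<open>\<Omega>\<close> itself, so only values of the
    gradient inside the domain count.\<close>
  moreover have "space (normalised_lebesgue \<Omega>) = \<Omega>"
    by (simp add: normalised_lebesgue_def)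
  ultimately show "compact (measure_support (distr (normalised_lebesgue \<Omega>) borel (grad (P t))))"
    by (simp add: compact_measure_support_distr)
qed

end
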